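(* Let $\sigma\ge0$, let $\mathcal D,\mathcal U\subset\mathbb R^2$ be bounded domains with $\mathrm{dist}(\mathcal U,\mathcal D)=r_0>0$. A function $\mu\in C_0^\infty(\mathcal D)$ with $\mu\ge0$ is uniquely determined by $$T(x)=\frac1{2^3\pi}\int_{\mathbb R^2}\frac{e^{-\sigma|x-y|}}{|x-y|}\mu(y)\,dy,\qquad x\in\mathcal U.$$ That is, if $\mu_1,\mu_2\in C_0^\infty(\mathcal D)$ are nonnegative and the corresponding functions $T_1,T_2$ satisfy $T_1(x)=T_2(x)$ for all $x\in\mathcal U$, then $\mu_1=\mu_2$.
   Context: A domain is a nonempty connected open set; $C_0^\infty(\mathcal D)$ is the space of smooth (real-valued) functions with compact support in $\mathcal D$. The number $\sigma$ is fixed and known. *)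

theory Defs
  imports "HOL-Analysis.Analysis"
begin

definition is_domain :: "'a::topological_space set \<Rightarrow> bool" where
  "is_domain S \<longleftrightarrow> S \<noteq> {} \<and> open S \<and> connected S"

text \<open>\<open>C_k k f\<close> says that \<open>f\<close> is of class \<open>C\<^sup>k\<close> on the whole space: \<open>f\<close> is continuous if \<open>k = 0\<close>;
  otherwise it is (Frechet) differentiable everywhere and each of its directional derivatives
  is of class \<open>C\<^sup>k\<^sup>-\<^sup>1\<close>.\<close>

primrec C_k :: "nat \<Rightarrow> ('a::euclidean_space \<Rightarrow> real) \<Rightarrow> bool" where
  "C_k 0 f \<longleftrightarrow> continuous_on UNIV f"
| "C_k (Suc k) f \<longleftrightarrow>
     (\<forall>x. f differentiable (at x)) \<and> (\<forall>v. C_k k (\<lambda>x. frechet_derivative f (at x) v))"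

definition smooth :: "('a::euclidean_space \<Rightarrow> real) \<Rightarrow> bool" where
  "smooth f \<longleftrightarrow> (\<forall>k. C_k k f)"

definition supp :: "('a::topological_space \<Rightarrow> real) \<Rightarrow> 'a set" where
  "supp f = closure {x. f x \<noteq> 0}"

text \<open>Elements of \<open>C\<^sub>0\<^sup>\<infinity>(D)\<close> are represented by their extensions by zero to the whole space.\<close>

definition C0_infinity :: "'a::euclidean_space set \<Rightarrow> ('a \<Rightarrow> real) set" where
  "C0_infinity D = {f. smooth f \<and> compact (supp f) \<and> supp f \<subseteq> D}"

definition T_data :: "real \<Rightarrow> (real^2 \<Rightarrow> real) \<Rightarrow> real^2 \<Rightarrow> real" where
  "T_data \<sigma> \<mu> x =
     1 / (2 ^ 3 * pi) * (LINT y|lborel. exp (- \<sigma> * norm (x - y)) / norm (x - y) * \<mu> y)"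

end

theory Submission
  imports Defs "HOL-Complex_Analysis.Complex_Analysis"
begin

text \<open>
  Let \<open>k(s) = exp (- \<sigma> \<surd>s) / \<surd>s\<close> and \<open>f = \<mu>\<^sub>1 - \<mu>\<^sub>2\<close>; the hypothesis says that
  \<open>\<integral> k(|x - y|\<^sup>2) f(y) dy = 0\<close> on \<open>U\<close>. Because of \<open>4 s k'' + 6 k' = \<sigma>\<^sup>2 k\<close> (the Helmholtz equation in
  space), the planar Laplacian maps the potential with kernel \<open>k\<^sup>(\<^sup>n\<^sup>)\<close> to a combination of those with
  kernels \<open>k\<^sup>(\<^sup>n\<^sup>)\<close> and \<open>k\<^sup>(\<^sup>n\<^sup>+\<^sup>1\<^sup>)\<close>, so by induction all of them vanish on \<open>U\<close>. These are the Taylor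
  coefficients at \<open>w = 0\<close> of \<open>\<integral> k(|x - y|\<^sup>2 + w) f(y) dy\<close>, which is therefore zero for all \<open>w > 0\<close>: the
  potential vanishes at height \<open>\<surd>w\<close> above \<open>U\<close>. Off the plane it is real analytic along
  horizontal lines, hence zero at every \<open>x\<close>. Finally \<open>- \<surd>w k'(|x - y|\<^sup>2 + w)\<close> is a positive kernel that
  concentrates at \<open>x\<close> as \<open>w \<rightarrow> 0\<close>, which forces \<open>f(x) = 0\<close>.
\<close>

section \<open>The Yukawa kernel as a holomorphic function of the squared distance\<close>

definition yukawa :: "real \<Rightarrow> complex \<Rightarrow> complex" where
  "yukawa \<sigma> z = exp (- of_real \<sigma> * csqrt z) / csqrt z"

abbreviation yukawa_deriv :: "real \<Rightarrow> nat \<Rightarrow> complex \<Rightarrow> complex" where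
  "yukawa_deriv \<sigma> n \<equiv> (deriv ^^ n) (yukawa \<sigma>)"

lemma open_right_halfplane: "open {z. 0 < Re z}"
  by (simp add: open_halfspace_Re_gt)

text \<open>The squared distance serves as variable because it is a polynomial in the coordinates
  and so extends to complex positions. The principal root is holomorphic and nonzero on the right
  half-plane, where membership is a mere bound on the real part.\<close>

lemma holomorphic_yukawa_deriv: "yukawa_deriv \<sigma> n holomorphic_on {z. 0 < Re z}"
proof (rule holomorphic_higher_deriv)
  show "yukawa \<sigma> holomorphic_on {z. 0 < Re z}"
    unfolding yukawa_def
    by (intro holomorphic_intros) (auto simp: complex_nonpos_Reals_iff)
qed (rule open_right_halfplane)

lemma has_field_derivative_yukawa_deriv:
  assumes "0 < Re z"
  shows "(yukawa_deriv \<sigma> n has_field_derivative yukawa_deriv \<sigma> (Suc n) z) (at z)"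
  using holomorphic_derivI[OF holomorphic_yukawa_deriv[of n \<sigma>] open_right_halfplane, of z] assms
  by simp

lemma continuous_on_yukawa_deriv:
  assumes "continuous_on A h" "\<And>p. p \<in> A \<Longrightarrow> 0 < Re (h p)"
  shows "continuous_on A (\<lambda>p. yukawa_deriv \<sigma> n (h p))"
  by (rule continuous_on_compose2[OF holomorphic_on_imp_continuous_on[OF holomorphic_yukawa_deriv] assms(1)])
     (use assms(2) in auto)

text \<open>The derivatives of the kernel are computed in the variable \<open>csqrt z\<close>, where
  they are exponentials times rational functions.\<close>

lemma has_field_derivative_compose_csqrt:
  assumes "0 < Re z" "(h has_field_derivative D) (at (csqrt z))"
  shows "((\<lambda>z. h (csqrt z)) has_field_derivative D / (2 * csqrt z)) (at z)"
proof -
  have "(csqrt has_field_derivative inverse (2 * csqrt z)) (at z)"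
    using assms(1) by (intro has_field_derivative_csqrt) (auto simp: complex_nonpos_Reals_iff)
  from DERIV_chain2[OF assms(2) this] show ?thesis
    by (simp only: divide_inverse)
qed

lemma yukawa_deriv_1:
  assumes "0 < Re z"
  shows "yukawa_deriv \<sigma> 1 z =
    - (of_real \<sigma> * csqrt z + 1) * exp (- of_real \<sigma> * csqrt z) / (2 * csqrt z ^ 3)"
proof -
  have nz: "csqrt z \<noteq> 0" using assms by auto
  have D: "((\<lambda>r. exp (- of_real \<sigma> * r) / r) has_field_derivative
      - (of_real \<sigma> * r + 1) * exp (- of_real \<sigma> * r) / r ^ 2) (at r)" if "r \<noteq> 0" for r :: complex
    using that
    by (auto intro!: derivative_eq_intros simp: field_simps power2_eq_square)
  show ?thesis
    using DERIV_imp_deriv[OF has_field_derivative_compose_csqrt[OF assms D[OF nz]]]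
    by (simp add: yukawa_def[abs_def] power3_eq_cube power2_eq_square mult_ac del: power2_csqrt)
qed

lemma yukawa_deriv_2:
  assumes "0 < Re z"
  shows "yukawa_deriv \<sigma> 2 z =
    (of_real \<sigma> ^ 2 * csqrt z ^ 2 + 3 * of_real \<sigma> * csqrt z + 3) * exp (- of_real \<sigma> * csqrt z)
      / (4 * csqrt z ^ 5)"
proof -
  have nz: "csqrt z \<noteq> 0" using assms by auto
  let ?h = "\<lambda>r. - (of_real \<sigma> * r + 1) * exp (- of_real \<sigma> * r) / (2 * r ^ 3)"
  have D: "(?h has_field_derivative
      (of_real \<sigma> ^ 2 * r ^ 2 + 3 * of_real \<sigma> * r + 3) * exp (- of_real \<sigma> * r) / (2 * r ^ 4)) (at r)"
    if "r \<noteq> 0" for r :: complex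
    using that
    by (auto intro!: derivative_eq_intros simp: divide_simps)
       (simp add: algebra_simps eval_nat_numeral)
  have "eventually (\<lambda>z. yukawa_deriv \<sigma> 1 z = ?h (csqrt z)) (nhds z)"
    using eventually_nhds_in_open[OF open_right_halfplane, of z] assms
    by (auto elim!: eventually_mono simp: yukawa_deriv_1 simp del: funpow.simps One_nat_def)
  then have "deriv (yukawa_deriv \<sigma> 1) z = deriv (\<lambda>z. ?h (csqrt z)) z"
    by (intro deriv_cong_ev) auto
  also have "\<dots> = (of_real \<sigma> ^ 2 * csqrt z ^ 2 + 3 * of_real \<sigma> * csqrt z + 3)
      * exp (- of_real \<sigma> * csqrt z) / (2 * csqrt z ^ 4) / (2 * csqrt z)"
    by (intro DERIV_imp_deriv has_field_derivative_compose_csqrt assms D nz)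
  also have "\<dots> = (of_real \<sigma> ^ 2 * csqrt z ^ 2 + 3 * of_real \<sigma> * csqrt z + 3)
      * exp (- of_real \<sigma> * csqrt z) / (4 * csqrt z ^ 5)"
    unfolding divide_divide_eq_left by (rule arg_cong2[where f = divide]) (simp_all add: eval_nat_numeral)
  finally show ?thesis
    by (simp add: numeral_2_eq_2)
qed

text \<open>For \<open>u(r) = k(r^2)\<close> and \<open>z = r^2\<close>, the expression
  \<open>4 z k'' + 6 k'\<close> is the radial Laplacian \<open>u'' + 2 u' / r\<close> of
  three-dimensional space. The case \<open>n = 0\<close> is checked on the closed forms; each
  differentiation of the equation raises the coefficient 6 by 4, from the factor
  \<open>4 * z\<close>.\<close>

lemma yukawa_ode:
  assumes "0 < Re z"
  shows "4 * z * yukawa_deriv \<sigma> (n + 2) z + (6 + 4 * of_nat n) * yukawa_deriv \<sigma> (n + 1) z =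
    of_real \<sigma> ^ 2 * yukawa_deriv \<sigma> n z"
  using assms
proof (induction n arbitrary: z)
  case 0
  then have nz: "csqrt z \<noteq> 0" by auto
  have id: "4 * r\<^sup>2 * ((c\<^sup>2 * r\<^sup>2 + 3 * c * r + 3) * E / (4 * r ^ 5))
      + 6 * (- (c * r + 1) * E / (2 * r ^ 3)) = c\<^sup>2 * (E / r)" if "r \<noteq> 0" for r c E :: complex
    using that by (simp add: field_simps eval_nat_numeral)
  have "4 * z * yukawa_deriv \<sigma> 2 z + 6 * yukawa_deriv \<sigma> 1 z = of_real \<sigma> ^ 2 * yukawa \<sigma> z"
    unfolding yukawa_deriv_1[OF 0] yukawa_deriv_2[OF 0] yukawa_def
    using id[OF nz, of "of_real \<sigma>" "exp (- of_real \<sigma> * csqrt z)"]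
    by (simp only: power2_csqrt)
  then show ?case by (simp add: numeral_2_eq_2)
next
  case (Suc n)
  let ?L = "\<lambda>z. 4 * z * yukawa_deriv \<sigma> (n + 2) z + (6 + 4 * of_nat n) * yukawa_deriv \<sigma> (n + 1) z"
  have "(?L has_field_derivative 4 * z * yukawa_deriv \<sigma> (Suc n + 2) z
      + 4 * yukawa_deriv \<sigma> (n + 2) z + (6 + 4 * of_nat n) * yukawa_deriv \<sigma> (n + 2) z) (at z)"
    using has_field_derivative_yukawa_deriv[OF Suc.prems, where \<sigma> = \<sigma> and n = "n + 2"]
      has_field_derivative_yukawa_deriv[OF Suc.prems, where \<sigma> = \<sigma> and n = "n + 1"]
    by (auto intro!: derivative_eq_intros simp del: funpow.simps simp: algebra_simps)
  then have "deriv ?L z = 4 * z * yukawa_deriv \<sigma> (Suc n + 2) z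
      + 4 * yukawa_deriv \<sigma> (n + 2) z + (6 + 4 * of_nat n) * yukawa_deriv \<sigma> (n + 2) z"
    by (rule DERIV_imp_deriv)
  moreover have "eventually (\<lambda>z. ?L z = of_real \<sigma> ^ 2 * yukawa_deriv \<sigma> n z) (nhds z)"
    using eventually_nhds_in_open[OF open_right_halfplane, of z] Suc
    by (auto elim!: eventually_mono simp del: funpow.simps)
  then have "deriv ?L z = deriv (\<lambda>z. of_real \<sigma> ^ 2 * yukawa_deriv \<sigma> n z) z"
    by (rule deriv_cong_ev) simp
  moreover have "((\<lambda>z. of_real \<sigma> ^ 2 * yukawa_deriv \<sigma> n z) has_field_derivative
      of_real \<sigma> ^ 2 * yukawa_deriv \<sigma> (Suc n) z) (at z)"
    by (intro DERIV_cmult has_field_derivative_yukawa_deriv Suc.prems)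
  then have "deriv (\<lambda>z. of_real \<sigma> ^ 2 * yukawa_deriv \<sigma> n z) z =
      of_real \<sigma> ^ 2 * yukawa_deriv \<sigma> (Suc n) z"
    by (rule DERIV_imp_deriv)
  ultimately have "4 * z * yukawa_deriv \<sigma> (Suc n + 2) z
      + 4 * yukawa_deriv \<sigma> (n + 2) z + (6 + 4 * of_nat n) * yukawa_deriv \<sigma> (n + 2) z
      = of_real \<sigma> ^ 2 * yukawa_deriv \<sigma> (Suc n) z"
    by (simp only:)
  then show ?case
    by (simp add: algebra_simps del: funpow.simps)
qed

section \<open>Pairing complex kernels with a compactly supported density\<close>

locale compact_density =
  fixes f :: "real^2 \<Rightarrow> real" and S :: "(real^2) set" and a b :: "real^2"
  assumes continuous: "continuous_on UNIV f"
    and closed: "closed S" and subset: "S \<subseteq> cbox a b"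
    and zero_outside: "\<And>y. y \<notin> S \<Longrightarrow> f y = 0"
begin

text \<open>A gauge integral over a fixed box, so that the Leibniz rule for boxes applies. The
  kernels are complex because position and height will be complexified. \<open>S\<close> may be
  larger than the support of \<open>f\<close>.\<close>

definition pairing :: "(real^2 \<Rightarrow> complex) \<Rightarrow> complex" where
  "pairing h = integral (cbox a b) (\<lambda>y. h y * of_real (f y))"

text \<open>Kernels may be singular at points of the box outside \<open>S\<close>. On the open set
  \<open>UNIV \<times> (- S)\<close> the product is zero, on the open set \<open>Q\<close> both
  factors are continuous, and the two sets cover \<open>A\<close>.\<close>

lemma continuous_on_mult_density:
  fixes h :: "'a::topological_space \<times> (real^2) \<Rightarrow> complex"
  assumes "open Q" "continuous_on Q h" "\<And>p. p \<in> A \<Longrightarrow> snd p \<in> S \<Longrightarrow> p \<in> Q"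
  shows "continuous_on A (\<lambda>p. h p * of_real (f (snd p)))"
proof -
  have "continuous_on (Q \<union> UNIV \<times> (- S)) (\<lambda>p. h p * of_real (f (snd p)))"
  proof (rule continuous_on_open_Un)
    show "continuous_on Q (\<lambda>p. h p * of_real (f (snd p)))"
      by (intro continuous_intros assms continuous_on_compose2[OF continuous]) auto
    show "continuous_on (UNIV \<times> (- S)) (\<lambda>p. h p * of_real (f (snd p)))"
      by (rule continuous_on_eq[OF continuous_on_const[of _ 0]]) (auto simp: zero_outside)
  qed (use assms closed in \<open>auto intro: open_Times\<close>)
  then show ?thesis
    by (rule continuous_on_subset) (use assms(3) in force)
qed

lemma continuous_on_mult_density_UNIV:
  fixes h :: "real^2 \<Rightarrow> complex"
  assumes "open Q" "S \<subseteq> Q" "continuous_on Q h"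
  shows "continuous_on UNIV (\<lambda>y. h y * of_real (f y))"
proof -
  \<comment> \<open>A dummy real coordinate makes this an instance of the lemma with a
    parameter.\<close>
  have *: "continuous_on (UNIV \<times> UNIV) (\<lambda>p. h (snd p) * of_real (f (snd (p :: real \<times> _))))"
    by (rule continuous_on_mult_density[where Q = "UNIV \<times> Q"])
       (use assms in \<open>auto intro: open_Times intro!: continuous_intros continuous_on_compose2[OF assms(3)]\<close>)
  show ?thesis
    using continuous_on_compose2[OF *, of UNIV "\<lambda>y. (0, y)"]
    by (simp add: continuous_on_Pair continuous_on_const continuous_on_id)
qed

lemma integrable_mult_density:
  fixes h :: "real^2 \<Rightarrow> complex"
  assumes "open Q" "S \<subseteq> Q" "continuous_on Q h"
  shows "(\<lambda>y. h y * of_real (f y)) integrable_on cbox a b"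
  by (intro integrable_continuous continuous_on_subset[OF continuous_on_mult_density_UNIV[OF assms]]) simp

lemma pairing_cong:
  assumes "\<And>y. y \<in> S \<Longrightarrow> h y = h' y"
  shows "pairing h = pairing h'"
  unfolding pairing_def by (rule integral_cong) (metis assms mult_zero_right of_real_0 zero_outside)

lemma pairing_add:
  assumes "open Q" "S \<subseteq> Q" "continuous_on Q h" "continuous_on Q h'"
  shows "pairing (\<lambda>y. h y + h' y) = pairing h + pairing h'"
  unfolding pairing_def
  by (simp add: distrib_right integral_add integrable_mult_density[OF assms(1,2)] assms(3,4))

lemma pairing_cmult: "pairing (\<lambda>y. c * h y) = c * pairing h"
  unfolding pairing_def by (simp add: mult.assoc)

text \<open>Differentiation under the integral sign. Differentiability of the kernel is asked only
  on an open set \<open>Q\<close> around \<open>W \<times> S\<close>; for \<open>y\<close> outside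
  \<open>S\<close> the integrand is zero for every \<open>z\<close>.\<close>

lemma has_field_derivative_pairing:
  fixes g g' :: "complex \<Rightarrow> real^2 \<Rightarrow> complex"
  assumes "open Q" "W \<times> S \<subseteq> Q" "open W" "convex W" "w \<in> W"
    and g: "continuous_on Q (\<lambda>(z, y). g z y)" and g': "continuous_on Q (\<lambda>(z, y). g' z y)"
    and der: "\<And>z y. (z, y) \<in> Q \<Longrightarrow> ((\<lambda>z. g z y) has_field_derivative g' z y) (at z)"
  shows "((\<lambda>z. pairing (g z)) has_field_derivative pairing (g' w)) (at w)"
proof -
  have "((\<lambda>z. pairing (g z)) has_field_derivative pairing (g' w)) (at w within W)"
    unfolding pairing_def
  proof (rule leibniz_rule_field_derivative[where U = W and ?x0.0 = w
        and f = "\<lambda>z y. g z y * of_real (f y)" and fx = "\<lambda>z y. g' z y * of_real (f y)"])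
    fix z y assume "z \<in> W"
    show "((\<lambda>z. g z y * of_real (f y)) has_field_derivative g' z y * of_real (f y)) (at z within W)"
    proof (cases "y \<in> S")
      case True
      then have "(z, y) \<in> Q"
        using \<open>z \<in> W\<close> assms(2) by blast
      then show ?thesis
        by (intro DERIV_cmult_right has_field_derivative_at_within[OF der])
    qed (simp add: zero_outside)
  next
    fix z assume "z \<in> W"
    show "(\<lambda>y. g z y * of_real (f y)) integrable_on cbox a b"
    proof (rule integrable_mult_density)
      have *: "continuous_on UNIV (Pair z :: real^2 \<Rightarrow> _)"
        by (intro continuous_intros)
      show "open (Pair z -` Q)"
        using assms(1) * by (rule open_vimage)
      have "continuous_on (Pair z -` Q) (\<lambda>y. case (z, y) of (z, y) \<Rightarrow> g z y)"
        by (rule continuous_on_compose2[OF g continuous_on_subset[OF *]]) auto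
      then show "continuous_on (Pair z -` Q) (g z)"
        by simp
    qed (use \<open>z \<in> W\<close> assms(2) in blast)+
  next
    have "continuous_on (W \<times> cbox a b) (\<lambda>p. (case p of (z, y) \<Rightarrow> g' z y) * of_real (f (snd p)))"
    proof (rule continuous_on_mult_density[OF assms(1) g'])
      fix p assume "p \<in> W \<times> cbox a b" "snd p \<in> S"
      then have "p \<in> W \<times> S"
        by (auto simp: mem_Times_iff)
      with assms(2) show "p \<in> Q" by blast
    qed
    then show "continuous_on (W \<times> cbox a b) (\<lambda>(z, y). g' z y * of_real (f y))"
      by (simp only: case_prod_unfold)
  qed (fact assms)+
  then show ?thesis
    using at_within_open[OF assms(5,3)] by simp
qed

end

section \<open>Complexified squared distance along a line\<close>

lemma DERIV_zero_fun_eq_zero: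
  assumes "open W" "z \<in> W" "\<And>z. z \<in> W \<Longrightarrow> F z = 0" "(F has_field_derivative D) (at z)"
  shows "D = 0"
proof -
  have "((\<lambda>_. 0) has_field_derivative D) (at z)"
    by (rule has_field_derivative_transform_within_open[OF assms(4,1,2,3)])
  then show ?thesis
    using DERIV_const DERIV_unique by blast
qed

text \<open>The polynomial in \<open>z\<close> that equals \<open>|x + z e - y|\<^sup>2 + w\<close> for real \<open>z\<close> and a unit vector \<open>e\<close>.\<close>

definition phase :: "real \<Rightarrow> real^2 \<Rightarrow> real^2 \<Rightarrow> complex \<Rightarrow> real^2 \<Rightarrow> complex" where
  "phase w x e z y = of_real ((norm (x - y))\<^sup>2 + w) + 2 * z * of_real ((x - y) \<bullet> e) + z\<^sup>2"

lemma norm_sq_shift: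
  fixes x y e :: "'a::real_inner"
  assumes "norm e = 1"
  shows "(norm (x + t *\<^sub>R e - y))\<^sup>2 = (norm (x - y))\<^sup>2 + 2 * t * ((x - y) \<bullet> e) + t\<^sup>2"
proof -
  have "(norm (u + t *\<^sub>R e))\<^sup>2 = (norm u)\<^sup>2 + 2 * t * (u \<bullet> e) + t\<^sup>2" for u
    using assms unfolding power2_norm_eq_inner norm_eq_1
    by (simp add: inner_add_left inner_add_right inner_commute[of e u] power2_eq_square distrib_left)
  from this[of "x - y"] show ?thesis
    by (simp only: add_diff_eq diff_add_eq)
qed

text \<open>Tells where the composed kernel is holomorphic in \<open>z\<close>: it suffices that
  \<open>(Im z)\<^sup>2\<close> stays below \<open>w\<close> plus the squared distance of
  \<open>y\<close> from the shifted base point.\<close>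

lemma Re_phase:
  assumes "norm e = 1"
  shows "Re (phase w x e z y) = (norm (x + Re z *\<^sub>R e - y))\<^sup>2 + w - (Im z)\<^sup>2"
  unfolding norm_sq_shift[OF assms] by (simp add: phase_def power2_eq_square)

lemma phase_of_real:
  assumes "norm e = 1"
  shows "phase w x e (of_real t) y = of_real ((norm (x + t *\<^sub>R e - y))\<^sup>2 + w)"
  by (simp add: phase_def norm_sq_shift[OF assms])

lemma continuous_on_phase: "continuous_on A (\<lambda>p. phase w x e (fst p) (snd p))"
  unfolding phase_def by (intro continuous_intros)

lemma has_field_derivative_phase:
  "((\<lambda>z. phase w x e z y) has_field_derivative 2 * of_real ((x - y) \<bullet> e) + 2 * z) (at z)"
  unfolding phase_def by (auto intro!: derivative_eq_intros)

lemma has_field_derivative_yukawa_phase: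
  assumes "0 < Re (phase w x e z y)"
  shows "((\<lambda>z. yukawa_deriv \<sigma> n (phase w x e z y)) has_field_derivative
    yukawa_deriv \<sigma> (Suc n) (phase w x e z y) * (2 * of_real ((x - y) \<bullet> e) + 2 * z)) (at z)"
  by (rule DERIV_chain2[OF has_field_derivative_yukawa_deriv[OF assms] has_field_derivative_phase])

lemma has_field_derivative_yukawa_phase_2:
  assumes "0 < Re (phase w x e z y)"
  shows "((\<lambda>z. yukawa_deriv \<sigma> n (phase w x e z y) * (2 * of_real ((x - y) \<bullet> e) + 2 * z))
    has_field_derivative
    yukawa_deriv \<sigma> (Suc n) (phase w x e z y) * (2 * of_real ((x - y) \<bullet> e) + 2 * z)\<^sup>2
    + 2 * yukawa_deriv \<sigma> n (phase w x e z y)) (at z)"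
proof -
  have "((\<lambda>z. 2 * of_real ((x - y) \<bullet> e) + 2 * z) has_field_derivative 2) (at z)"
    by (auto intro!: derivative_eq_intros)
  from DERIV_mult[OF has_field_derivative_yukawa_phase[OF assms] this] show ?thesis
    by (simp only: power2_eq_square mult_ac)
qed

section \<open>Propagating zeros of the pairings\<close>

context compact_density
begin

context
  fixes \<sigma> w :: real and x e :: "real^2" and W :: "complex set" and r :: real and n :: nat
  assumes e: "norm e = 1" and W: "open W" "convex W" "0 \<in> W"
    and pos: "\<And>z y. z \<in> W \<Longrightarrow> y \<in> S \<Longrightarrow> 0 < Re (phase w x e z y)"
    and r: "0 < r"
    and zero: "\<And>t. \<bar>t\<bar> < r \<Longrightarrow>
      pairing (\<lambda>y. yukawa_deriv \<sigma> n (of_real ((norm (x + t *\<^sub>R e - y))\<^sup>2 + w))) = 0"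
begin

private abbreviation "Q \<equiv> {p. 0 < Re (phase w x e (fst p) (snd p))}"

private lemma open_Q: "open Q"
  by (intro open_Collect_less continuous_intros continuous_on_phase)

private lemma subset_Q: "W \<times> S \<subseteq> Q"
  using pos by auto

private lemma continuous_on_Q: "continuous_on Q (\<lambda>p. yukawa_deriv \<sigma> m (phase w x e (fst p) (snd p)))"
  by (rule continuous_on_yukawa_deriv[OF continuous_on_phase]) simp

private lemma deriv_pairing_phase:
  assumes "z \<in> W"
  shows "((\<lambda>z. pairing (\<lambda>y. yukawa_deriv \<sigma> n (phase w x e z y))) has_field_derivative
    pairing (\<lambda>y. yukawa_deriv \<sigma> (Suc n) (phase w x e z y) * (2 * of_real ((x - y) \<bullet> e) + 2 * z))) (at z)"
  by (rule has_field_derivative_pairing[OF open_Q subset_Q W(1,2) assms], unfold case_prod_unfold)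
     (auto simp del: funpow.simps
       intro!: has_field_derivative_yukawa_phase continuous_on_Q continuous_intros)

private lemma deriv_pairing_phase_2:
  assumes "z \<in> W"
  shows "((\<lambda>z. pairing (\<lambda>y. yukawa_deriv \<sigma> (Suc n) (phase w x e z y) * (2 * of_real ((x - y) \<bullet> e) + 2 * z)))
    has_field_derivative
    pairing (\<lambda>y. yukawa_deriv \<sigma> (Suc (Suc n)) (phase w x e z y) * (2 * of_real ((x - y) \<bullet> e) + 2 * z)\<^sup>2
      + 2 * yukawa_deriv \<sigma> (Suc n) (phase w x e z y))) (at z)"
  by (rule has_field_derivative_pairing[OF open_Q subset_Q W(1,2) assms], unfold case_prod_unfold)
     (auto simp del: funpow.simps
       intro!: has_field_derivative_yukawa_phase_2 continuous_on_Q continuous_intros)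

text \<open>Identity theorem: the pairing is holomorphic on the connected set \<open>W\<close> and
  vanishes at the real points of \<open>W\<close> near 0, which accumulate at 0. It is applied close
  to \<open>U\<close> with \<open>w = 0\<close> and along a whole line with
  \<open>w > 0\<close>.\<close>

lemma pairing_phase_eq_0:
  assumes "z \<in> W"
  shows "pairing (\<lambda>y. yukawa_deriv \<sigma> n (phase w x e z y)) = 0"
proof (rule analytic_continuation[where w = z
      and f = "\<lambda>z. pairing (\<lambda>y. yukawa_deriv \<sigma> n (phase w x e z y))" and S = W and U = "of_real ` {-r<..<r} \<inter> W" and \<xi> = 0])
  show "(\<lambda>z. pairing (\<lambda>y. yukawa_deriv \<sigma> n (phase w x e z y))) holomorphic_on W"
    using deriv_pairing_phase W(1) holomorphic_on_open by blast
  show "(0 :: complex) islimpt of_real ` {-r<..<r} \<inter> W"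
    unfolding islimpt_approachable
  proof (intro allI impI)
    fix d :: real assume "0 < d"
    obtain c where c: "0 < c" "ball 0 c \<subseteq> W"
      using W open_contains_ball by blast
    define t where "t = min (min c d) r / 2"
    have t: "0 < t" "t < c" "t < d" "t < r"
      using c \<open>0 < d\<close> r by (auto simp: t_def)
    then have "of_real t \<in> W"
      using c(2) by (intro subsetD[OF c(2)]) simp
    with t show "\<exists>z\<in>of_real ` {-r<..<r} \<inter> W. z \<noteq> 0 \<and> dist z (0::complex) < d"
      by (intro bexI[of _ "of_real t"]) auto
  qed
  show "pairing (\<lambda>y. yukawa_deriv \<sigma> n (phase w x e z y)) = 0"
    if "z \<in> of_real ` {-r<..<r} \<inter> W" for z
    using that zero by (auto simp: phase_of_real[OF e] abs_less_iff)
qed (use W assms in \<open>auto simp: convex_connected\<close>)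

text \<open>Second derivative at 0 of the function just shown to vanish; the argument of the kernel
  has first derivative \<open>2 (x - y) \<bullet> e + 2 z\<close> and second derivative 2.\<close>

lemma pairing_second_derivative_eq_0:
  "pairing (\<lambda>y. yukawa_deriv \<sigma> (Suc (Suc n)) (phase w x e 0 y) * (2 * of_real ((x - y) \<bullet> e))\<^sup>2
      + 2 * yukawa_deriv \<sigma> (Suc n) (phase w x e 0 y)) = 0"
proof -
  have "pairing (\<lambda>y. yukawa_deriv \<sigma> (Suc n) (phase w x e z y) * (2 * of_real ((x - y) \<bullet> e) + 2 * z)) = 0"
    if "z \<in> W" for z
    by (rule DERIV_zero_fun_eq_zero[OF W(1) that pairing_phase_eq_0 deriv_pairing_phase[OF that]])
  from DERIV_zero_fun_eq_zero[OF W(1,3) this deriv_pairing_phase_2[OF W(3)]]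
  show ?thesis
    by (simp only: mult_zero_right add_0_right)
qed

end

text \<open>Second derivatives along the two axes add up to the planar Laplacian, with kernel
  \<open>4 s k^(n+2) + 4 k^(n+1)\<close> at \<open>s = |x - y|^2\<close>. The differential equation
  turns this into \<open>\<sigma>^2 k^(n) - (2 + 4 n) k^(n+1)\<close>. The first term pairs to zero
  and \<open>2 + 4 n\<close> is nonzero; for \<open>n = 0\<close> it is the gap between the 6 of
  space and the 4 of the plane.\<close>

lemma pairing_yukawa_deriv_Suc:
  assumes "open U" "0 < r" and far: "\<And>x y. x \<in> U \<Longrightarrow> y \<in> S \<Longrightarrow> r \<le> norm (x - y)"
    and zero: "\<And>x. x \<in> U \<Longrightarrow> pairing (\<lambda>y. yukawa_deriv \<sigma> n (of_real ((norm (x - y))\<^sup>2))) = 0"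
    and "x \<in> U"
  shows "pairing (\<lambda>y. yukawa_deriv \<sigma> (Suc n) (of_real ((norm (x - y))\<^sup>2))) = 0"
proof -
  let ?N = "\<lambda>y. complex_of_real ((norm (x - y))\<^sup>2)"
  let ?K = "\<lambda>m y. yukawa_deriv \<sigma> m (?N y)"
  let ?h = "\<lambda>e y. ?K (Suc (Suc n)) y * (2 * of_real ((x - y) \<bullet> e))\<^sup>2 + 2 * ?K (Suc n) y"
  obtain d where d: "0 < d" "ball x d \<subseteq> U"
    using \<open>open U\<close> \<open>x \<in> U\<close> open_contains_ball by blast
  have *: "pairing (?h e) = 0" if e: "norm e = 1" for e
  proof -
    have in_U: "x + t *\<^sub>R e \<in> U" if "\<bar>t\<bar> < d" for t
      using that e by (intro subsetD[OF d(2)]) (simp add: dist_norm)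
    have "pairing (\<lambda>y. yukawa_deriv \<sigma> (Suc (Suc n)) (phase 0 x e 0 y) * (2 * of_real ((x - y) \<bullet> e))\<^sup>2
      + 2 * yukawa_deriv \<sigma> (Suc n) (phase 0 x e 0 y)) = 0"
    \<comment> \<open>\<open>d\<close> keeps the shifted base point in \<open>U\<close>, hence at
      distance at least \<open>r\<close> from \<open>S\<close>; \<open>r\<close> keeps the imaginary
      part below that distance.\<close>
    proof (rule pairing_second_derivative_eq_0[where W = "ball 0 (min d r)" and r = d])
      fix z :: complex and y assume z: "z \<in> ball 0 (min d r)" and "y \<in> S"
      have "\<bar>Re z\<bar> < d" "\<bar>Im z\<bar> < r"
        using z abs_Re_le_cmod[of z] abs_Im_le_cmod[of z] by auto
      then have "\<bar>Im z\<bar> < norm (x + Re z *\<^sub>R e - y)"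
        using far[OF in_U \<open>y \<in> S\<close>] by fastforce
      then have "(Im z)\<^sup>2 < (norm (x + Re z *\<^sub>R e - y))\<^sup>2"
        by (metis abs_ge_zero power2_abs power_strict_mono zero_less_numeral)
      then show "0 < Re (phase 0 x e z y)"
        by (simp add: Re_phase[OF e])
    qed (use e d \<open>0 < r\<close> zero[OF in_U] in auto)
    then show ?thesis
      by (simp add: phase_def del: funpow.simps)
  qed
  have Q: "open (- {x})" "S \<subseteq> - {x}"
    using far[OF \<open>x \<in> U\<close>, of x] \<open>0 < r\<close> by auto
  have K: "continuous_on (- {x}) (?K m)" for m
    by (rule continuous_on_yukawa_deriv) (auto intro!: continuous_intros)
  have H: "continuous_on (- {x}) (?h e)" for e
    by (intro continuous_intros K)
  have "pairing (\<lambda>y. ?h (axis 1 1) y + ?h (axis 2 1) y) = 0"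
    unfolding pairing_add[OF Q H H] by (simp only: *[OF norm_axis_1] add_0_left)
  also have "pairing (\<lambda>y. ?h (axis 1 1) y + ?h (axis 2 1) y) =
    pairing (\<lambda>y. of_real \<sigma> ^ 2 * ?K n y + (- 2 - 4 * of_nat n) * ?K (Suc n) y)"
  proof (rule pairing_cong)
    fix y assume "y \<in> S"
    then have "0 < Re (?N y)" using Q by auto
    from yukawa_ode[OF this, of n \<sigma>]
    have ode: "4 * ?N y * ?K (Suc (Suc n)) y + (6 + 4 * of_nat n) * ?K (Suc n) y = of_real \<sigma> ^ 2 * ?K n y"
      by (simp only: add_2_eq_Suc' Suc_eq_plus1[symmetric])
    have "(norm (x - y))\<^sup>2 = ((x - y) \<bullet> axis 1 1)\<^sup>2 + ((x - y) \<bullet> axis 2 1)\<^sup>2"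
      unfolding power2_norm_eq_inner inner_axis by (simp add: inner_vec_def sum_2 power2_eq_square)
    then have "?N y = of_real ((x - y) \<bullet> axis 1 1) ^ 2 + of_real ((x - y) \<bullet> axis 2 1) ^ 2"
      by (simp only: of_real_add of_real_power)
    with ode show "?h (axis 1 1) y + ?h (axis 2 1) y =
        of_real \<sigma> ^ 2 * ?K n y + (- 2 - 4 * of_nat n) * ?K (Suc n) y"
      by algebra
  qed
  also have "\<dots> = of_real \<sigma> ^ 2 * pairing (?K n) + (- 2 - 4 * of_nat n) * pairing (?K (Suc n))"
    unfolding pairing_cmult[symmetric] by (intro pairing_add[OF Q] continuous_intros K)
  finally have "(- 2 - 4 * of_nat n) * pairing (?K (Suc n)) = 0"
    using zero[OF \<open>x \<in> U\<close>] by (simp only: mult_zero_right add_0_left)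
  moreover have "- 2 - 4 * of_nat n \<noteq> (0 :: complex)"
    by (simp add: complex_eq_iff)
  ultimately show ?thesis
    by simp
qed

text \<open>The pairing is holomorphic in the shift of the squared distance, and each
  differentiation raises the order of the kernel by one. The zeros for all orders thus kill every
  derivative at shift 0, and the identity theorem carries this to \<open>w\<close>.\<close>

lemma pairing_yukawa_deriv_translate:
  assumes "0 < r" and far: "\<And>y. y \<in> S \<Longrightarrow> r \<le> norm (x - y)"
    and zero: "\<And>n. pairing (\<lambda>y. yukawa_deriv \<sigma> n (of_real ((norm (x - y))\<^sup>2))) = 0"
    and "0 < w"
  shows "pairing (\<lambda>y. yukawa_deriv \<sigma> n (of_real ((norm (x - y))\<^sup>2 + w))) = 0"
proof -
  define G where "G n z = pairing (\<lambda>y. yukawa_deriv \<sigma> n (of_real ((norm (x - y))\<^sup>2) + z))" for n z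
  \<comment> \<open>As \<open>|x - y|^2\<close> is at least \<open>r^2\<close> on \<open>S\<close>,
    these shifts leave the argument in the right half-plane, and 0 is an interior point.\<close>
  let ?W = "{z. - (r\<^sup>2) < Re z}"
  let ?Q = "{p. 0 < Re (of_real ((norm (x - snd p))\<^sup>2) + fst p)}"
  have W: "open ?W" "convex ?W"
    by (simp_all add: open_halfspace_Re_gt convex_halfspace_Re_gt)
  have Q: "open ?Q"
    by (intro open_Collect_less continuous_intros)
  have WS: "?W \<times> S \<subseteq> ?Q"
  proof
    fix p assume p: "p \<in> ?W \<times> S"
    then have "r\<^sup>2 \<le> (norm (x - snd p))\<^sup>2"
      using far \<open>0 < r\<close> by (intro power_mono) auto
    with p show "p \<in> ?Q" by auto
  qed
  have der: "(G n has_field_derivative G (Suc n) z) (at z)" if "z \<in> ?W" for n z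
    unfolding G_def[abs_def]
  proof (rule has_field_derivative_pairing[OF Q WS W that])
    have "continuous_on ?Q (\<lambda>p. yukawa_deriv \<sigma> m (of_real ((norm (x - snd p))\<^sup>2) + fst p))" for m
      by (rule continuous_on_yukawa_deriv) (auto intro!: continuous_intros)
    then show "continuous_on ?Q (\<lambda>(z, y). yukawa_deriv \<sigma> n (of_real ((norm (x - y))\<^sup>2) + z))"
      "continuous_on ?Q (\<lambda>(z, y). yukawa_deriv \<sigma> (Suc n) (of_real ((norm (x - y))\<^sup>2) + z))"
      by (simp_all only: case_prod_unfold)
    fix z y assume "(z, y) \<in> ?Q"
    then have pos: "0 < Re (of_real ((norm (x - y))\<^sup>2) + z)" by simp
    show "((\<lambda>z. yukawa_deriv \<sigma> n (of_real ((norm (x - y))\<^sup>2) + z)) has_field_derivative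
        yukawa_deriv \<sigma> (Suc n) (of_real ((norm (x - y))\<^sup>2) + z)) (at z)"
      using has_field_derivative_yukawa_deriv[OF pos] by (simp only: DERIV_shift add.commute)
  qed
  have higher: "(deriv ^^ m) (G n) z = G (n + m) z" if "z \<in> ?W" for m z
    using that
  proof (induction m arbitrary: z)
    case (Suc m)
    have "eventually (\<lambda>z. (deriv ^^ m) (G n) z = G (n + m) z) (nhds z)"
      using eventually_nhds_in_open[OF W(1) Suc.prems] Suc.IH by (auto elim!: eventually_mono)
    then have "deriv ((deriv ^^ m) (G n)) z = deriv (G (n + m)) z"
      by (rule deriv_cong_ev) simp
    also have "\<dots> = G (n + Suc m) z"
      using DERIV_imp_deriv[OF der[OF Suc.prems]] by simp
    finally show ?case by simp
  qed simp
  have "G n (of_real w) = 0"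
  proof (rule holomorphic_fun_eq_0_on_connected[where f = "G n" and w = "of_real w" and S = ?W and z = 0])
    show "G n holomorphic_on ?W"
      using der W(1) holomorphic_on_open by blast
    show "(deriv ^^ m) (G n) 0 = 0" for m
      using \<open>0 < r\<close> by (subst higher) (simp_all add: G_def zero del: of_real_power)
    show "0 \<in> ?W" using \<open>0 < r\<close> by simp
    show "of_real w \<in> ?W"
      using \<open>0 < w\<close> by (auto intro: le_less_trans[of _ 0])
  qed (use W convex_connected in auto)
  then show ?thesis
    by (simp only: G_def of_real_add)
qed

text \<open>At squared height \<open>w > 0\<close> nothing is singular, not even above
  \<open>S\<close>, so the zeros near \<open>x\<^sub>0\<close> continue analytically along the line
  from \<open>x\<^sub>0\<close> through \<open>x\<close>.\<close>

lemma pairing_yukawa_deriv_everywhere: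
  assumes "open U" "x\<^sub>0 \<in> U" "0 < w"
    and zero: "\<And>x. x \<in> U \<Longrightarrow> pairing (\<lambda>y. yukawa_deriv \<sigma> n (of_real ((norm (x - y))\<^sup>2 + w))) = 0"
  shows "pairing (\<lambda>y. yukawa_deriv \<sigma> n (of_real ((norm (x - y))\<^sup>2 + w))) = 0"
proof (cases "x = x\<^sub>0")
  case False
  define e where "e = (x - x\<^sub>0) /\<^sub>R norm (x - x\<^sub>0)"
  have e: "norm e = 1" and x: "x = x\<^sub>0 + norm (x - x\<^sub>0) *\<^sub>R e"
    using False by (auto simp: e_def)
  obtain d where d: "0 < d" "ball x\<^sub>0 d \<subseteq> U"
    using assms(1,2) open_contains_ball by blast
  \<comment> \<open>On this strip \<open>(Im z)\<^sup>2 < w\<close>, so the phase has positive real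
    part for every \<open>y\<close>; the strip contains the real axis and with it the parameter of
    \<open>x\<close>.\<close>
  let ?W = "{z. Im z < sqrt w} \<inter> {z. - sqrt w < Im z}"
  have "pairing (\<lambda>y. yukawa_deriv \<sigma> n (phase w x\<^sub>0 e (of_real (norm (x - x\<^sub>0))) y)) = 0"
  proof (rule pairing_phase_eq_0[where W = ?W and r = d])
    show "open ?W" "convex ?W"
      by (auto simp: open_halfspace_Im_lt open_halfspace_Im_gt
          intro!: convex_Int convex_halfspace_Im_lt convex_halfspace_Im_gt)
    fix z :: complex and y assume "z \<in> ?W"
    then have "sqrt ((Im z)\<^sup>2) < sqrt w" by auto
    then have "(Im z)\<^sup>2 < w"
      by (simp only: real_sqrt_less_iff)
    then show "0 < Re (phase w x\<^sub>0 e z y)"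
      unfolding Re_phase[OF e] using zero_le_power2[of "norm (x\<^sub>0 + Re z *\<^sub>R e - y)"] by linarith
  next
    fix t :: real assume "\<bar>t\<bar> < d"
    then have "x\<^sub>0 + t *\<^sub>R e \<in> U"
      using e by (intro subsetD[OF d(2)]) (simp add: dist_norm)
    then show "pairing (\<lambda>y. yukawa_deriv \<sigma> n (of_real ((norm (x\<^sub>0 + t *\<^sub>R e - y))\<^sup>2 + w))) = 0"
      by (rule zero)
  qed (use e d \<open>0 < w\<close> in auto)
  then show ?thesis
    unfolding phase_of_real[OF e] x[symmetric] .
qed (use assms in auto)

end

section \<open>A concentrating kernel and recovery of the density\<close>

definition radial_kernel :: "real \<Rightarrow> real \<Rightarrow> real" where
  "radial_kernel \<sigma> r = (\<sigma> * r + 1) * exp (- \<sigma> * r) / r ^ 3"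

text \<open>\<open>radial_kernel\<close> is \<open>- (1 / r) d/dr\<close> of
  \<open>exp (- \<sigma> r) / r\<close>. Multiplied by the height it is, up to sign, the vertical
  derivative of the potential kernel; for \<open>\<sigma> = 0\<close> this is a multiple of the
  Poisson kernel of the half-space.\<close>

lemma yukawa_deriv_1_of_real:
  assumes "0 < s"
  shows "yukawa_deriv \<sigma> 1 (of_real s) = of_real (- radial_kernel \<sigma> (sqrt s) / 2)"
proof -
  have "csqrt (of_real s) = of_real (sqrt s)" "0 < Re (of_real s)"
    using assms by (simp_all add: csqrt_of_real)
  with yukawa_deriv_1[of "of_real s" \<sigma>] show ?thesis
    by (simp add: radial_kernel_def exp_of_real[symmetric] mult.commute[of _ 2])
       (simp add: minus_divide_left[symmetric] algebra_simps add_divide_distrib diff_divide_distrib)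
qed

text \<open>\<open>1 + u \<le> exp u\<close> for \<open>u = \<sigma> r\<close> removes the
  exponential. The bound does not depend on the height and controls the points away from
  \<open>x\<close>.\<close>

lemma radial_kernel_le:
  assumes "0 \<le> \<sigma>" "0 < d" "d \<le> r"
  shows "radial_kernel \<sigma> r \<le> 1 / d ^ 3"
proof -
  have "(\<sigma> * r + 1) * exp (- \<sigma> * r) \<le> exp (\<sigma> * r) * exp (- \<sigma> * r)"
    using exp_ge_add_one_self[of "\<sigma> * r"] by (intro mult_right_mono) (auto simp: add.commute)
  also have "\<dots> = 1"
    by (simp add: exp_add[symmetric])
  finally have "radial_kernel \<sigma> r \<le> 1 / r ^ 3"
    unfolding radial_kernel_def using assms by (intro divide_right_mono) auto
  also have "\<dots> \<le> 1 / d ^ 3"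
    using assms by (intro divide_left_mono power_mono mult_pos_pos) auto
  finally show ?thesis .
qed

text \<open>At height \<open>t\<close> and horizontal distance below \<open>t\<close> one has
  \<open>r \<le> 2 t\<close>. The order \<open>t^-3\<close> outweighs the area of the disc, of order
  \<open>t^2\<close>.\<close>

lemma radial_kernel_ge:
  assumes "0 \<le> \<sigma>" "0 < r" "r \<le> 2 * t" "t \<le> 1"
  shows "exp (- 2 * \<sigma>) / (8 * t ^ 3) \<le> radial_kernel \<sigma> r"
proof -
  have t: "0 < t" using assms by auto
  have "\<sigma> * r \<le> \<sigma> * 2"
    using assms by (intro mult_left_mono) auto
  then have "exp (- 2 * \<sigma>) \<le> 1 * exp (- \<sigma> * r)"
    by simp
  also have "\<dots> \<le> (\<sigma> * r + 1) * exp (- \<sigma> * r)"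
    using assms by (intro mult_right_mono) auto
  finally have "exp (- 2 * \<sigma>) / (2 * t) ^ 3 \<le> (\<sigma> * r + 1) * exp (- \<sigma> * r) / r ^ 3"
    using assms t by (intro frac_le power_mono) auto
  then show ?thesis
    unfolding radial_kernel_def by (simp add: power_mult_distrib)
qed

context compact_density
begin

lemma pairing_of_real:
  assumes "open Q" "S \<subseteq> Q" "continuous_on Q g"
  shows "pairing (\<lambda>y. of_real (g y)) = of_real (integral (cbox a b) (\<lambda>y. g y * f y))"
proof -
  have "continuous_on Q (\<lambda>y. complex_of_real (g y))"
    by (intro continuous_intros assms)
  from integrable_mult_density[OF assms(1,2) this]
  have "((\<lambda>y. of_real (g y) * of_real (f y)) has_integral pairing (\<lambda>y. of_real (g y))) (cbox a b)"
    unfolding pairing_def by (rule integrable_integral)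
  then have *: "((\<lambda>y. complex_of_real (g y * f y)) has_integral pairing (\<lambda>y. of_real (g y))) (cbox a b)"
    by (simp only: of_real_mult)
  from has_integral_linear[OF * bounded_linear_Re]
  have "((\<lambda>y. g y * f y) has_integral Re (pairing (\<lambda>y. of_real (g y)))) (cbox a b)"
    by (simp add: o_def)
  from has_integral_unique[OF * has_integral_linear[OF this bounded_linear_of_real, unfolded o_def]]
    integral_unique[OF this]
  show ?thesis by simp
qed

text \<open>Bridge from the Lebesgue integral in \<open>T_data\<close> to the gauge integral: the
  integrand is continuous on the box and zero outside it.\<close>

lemma pairing_eq_LINT:
  assumes "open Q" "S \<subseteq> Q" "continuous_on Q g"
  shows "pairing (\<lambda>y. of_real (g y)) = of_real (LINT y|lborel. g y * f y)"
proof -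
  have "continuous_on UNIV (\<lambda>y. complex_of_real (g y) * of_real (f y))"
    by (intro continuous_on_mult_density_UNIV[OF assms(1,2)] continuous_intros assms)
  from continuous_on_Re[OF this] have "continuous_on (cbox a b) (\<lambda>y. g y * f y)"
    by (auto intro: continuous_on_subset)
  from borel_integrable_compact[OF compact_cbox this]
  have "integrable lborel (\<lambda>y. indicator (cbox a b) y *\<^sub>R (g y * f y))" .
  also have ind: "(\<lambda>y. indicator (cbox a b) y *\<^sub>R (g y * f y)) = (\<lambda>y. g y * f y)"
    using subset zero_outside by (fastforce simp: indicator_def)
  finally have "(LINT y|lborel. g y * f y) = integral UNIV (\<lambda>y. g y * f y)"
    by (rule integral_lborel[symmetric])
  also have "\<dots> = integral UNIV (\<lambda>y. if y \<in> cbox a b then g y * f y else 0)"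
    using subset zero_outside by (intro arg_cong[where f = "integral UNIV"]) fastforce
  also have "\<dots> = integral (cbox a b) (\<lambda>y. g y * f y)"
    by (rule Henstock_Kurzweil_Integration.integral_restrict_UNIV)
  finally show ?thesis
    using pairing_of_real[OF assms] by simp
qed

text \<open>If \<open>f x\<close> were nonzero, the disc of radius \<open>t\<close> about
  \<open>x\<close> would contribute at least \<open>C / t\<close> to an integral that is zero, while
  points at distance \<open>d\<close> or more contribute a bounded amount and those in between have
  the right sign.\<close>

lemma density_eq_0:
  assumes "0 \<le> \<sigma>"
    and zero: "\<And>w. 0 < w \<Longrightarrow> pairing (\<lambda>y. yukawa_deriv \<sigma> 1 (of_real ((norm (x - y))\<^sup>2 + w))) = 0"
  shows "f x = 0"
proof (rule ccontr)
  assume nz: "f x \<noteq> 0"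
  \<comment> \<open>Multiplying by the constant \<open>f x\<close> makes the value at
    \<open>x\<close> a positive square and treats both signs at once.\<close>
  define F where "F y = f x * f y" for y
  define c where "c = F x / 2"
  have c: "0 < c" "c < F x"
    using nz by (auto simp: c_def F_def zero_less_mult_iff linorder_neq_iff)
  have F_cont: "continuous_on A F" for A
    unfolding F_def using continuous by (intro continuous_intros) (auto intro: continuous_on_subset)
  have "open {y. c < F y}"
    by (intro open_Collect_less F_cont continuous_intros)
  moreover have "x \<in> {y. c < F y}"
    using c(2) by simp
  ultimately obtain d where d: "0 < d" and "ball x d \<subseteq> {y. c < F y}"
    by (rule openE)
  then have ball: "\<And>y. y \<in> ball x d \<Longrightarrow> c < F y"
    by blast
  have ball_cbox: "ball x d \<subseteq> cbox a b"
  proof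
    fix y assume "y \<in> ball x d"
    then have "F y \<noteq> 0" using ball c(1) by fastforce
    then show "y \<in> cbox a b" using zero_outside subset by (auto simp: F_def)
  qed
  have "bounded (F ` cbox a b)"
    by (intro compact_imp_bounded compact_continuous_image F_cont) simp
  then obtain M where M: "0 < M" "\<And>y. y \<in> cbox a b \<Longrightarrow> \<bar>F y\<bar> \<le> M"
    unfolding bounded_pos by auto
  define V where "V = measure lborel (cbox a b)"
  \<comment> \<open>Lower bound \<open>c * exp (- 2 * \<sigma>) / (8 * t ^ 3)\<close> near
    \<open>x\<close> times the disc area \<open>unit_ball_vol 2 * t^2\<close> is
    \<open>C / t\<close>; here \<open>t\<close> is the height, so \<open>w = t^2\<close>.\<close>
  define C where "C = c * exp (- 2 * \<sigma>) * unit_ball_vol 2 / 8"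
  have C: "0 < C" using c by (simp add: C_def)
  have bound: "C \<le> t * (M / d ^ 3 * V)" if t: "0 < t" "t < d" "t \<le> 1" for t
  proof -
    define g where "g y = radial_kernel \<sigma> (sqrt ((norm (x - y))\<^sup>2 + t\<^sup>2))" for y
    have pos: "0 < (norm (x - y))\<^sup>2 + t\<^sup>2" for y
      using t by (simp add: add_nonneg_pos)
    have g_cont: "continuous_on UNIV g"
      unfolding g_def radial_kernel_def
      by (intro continuous_intros) (use pos in \<open>force simp: real_sqrt_eq_zero_cancel_iff\<close>)
    have "pairing (\<lambda>y. of_real (g y)) = -2 * pairing (\<lambda>y. yukawa_deriv \<sigma> 1 (of_real ((norm (x - y))\<^sup>2 + t\<^sup>2)))"
      unfolding yukawa_deriv_1_of_real[OF pos] pairing_cmult[symmetric] g_def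
      by (rule arg_cong[where f = pairing]) auto
    also have "\<dots> = 0"
      using zero[of "t\<^sup>2"] t by simp
    finally have "integral (cbox a b) (\<lambda>y. g y * f y) = 0"
      using pairing_of_real[OF open_UNIV _ g_cont] by simp
    moreover have "(\<lambda>y. g y * f y) integrable_on cbox a b"
      by (intro integrable_continuous continuous_intros continuous_on_subset[OF g_cont]
          continuous_on_subset[OF continuous]) auto
    ultimately have "((\<lambda>y. g y * f y) has_integral 0) (cbox a b)"
      by (metis integrable_integral)
    from has_integral_mult_right[OF this, of "f x"]
    have int_0: "((\<lambda>y. g y * F y) has_integral 0) (cbox a b)"
      by (simp add: F_def mult.left_commute)
    define A where "A = c * (exp (- 2 * \<sigma>) / (8 * t ^ 3))"
    have ball_Int: "ball x t \<inter> cbox a b = ball x t"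
      using t ball_cbox subset_ball[of t d x] by auto
    have "(indicat_real (ball x t) has_integral measure lborel (ball x t)) (cbox a b)"
      using integrable_on_indicator[of "ball x t" "cbox a b"]
        Equivalence_Lebesgue_Henstock_Integration.integral_indicator[of "ball x t" "cbox a b"]
      unfolding ball_Int by (simp add: has_integral_iff)
    then have int: "((\<lambda>y. A * indicator (ball x t) y - M / d ^ 3) has_integral
        (A * measure lborel (ball x t) - M / d ^ 3 * V)) (cbox a b)"
      using has_integral_const[of "M / d ^ 3" a b] unfolding V_def
      by (intro has_integral_diff has_integral_mult_right) (simp_all add: mult.commute)
    \<comment> \<open>Subtracting \<open>M / d ^ 3\<close> on the whole box, not only away from
      \<open>x\<close>, just lowers the minorant and makes its integral immediate.\<close>
    have "A * indicator (ball x t) y - M / d ^ 3 \<le> g y * F y" if y: "y \<in> cbox a b" for y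
    proof (cases "y \<in> ball x d")
      case True
      have r: "0 < sqrt ((norm (x - y))\<^sup>2 + t\<^sup>2)" using pos by simp
      have g0: "0 \<le> g y"
        unfolding g_def radial_kernel_def using r \<open>0 \<le> \<sigma>\<close> by (intro divide_nonneg_nonneg mult_nonneg_nonneg add_nonneg_nonneg) auto
      show ?thesis
      proof (cases "y \<in> ball x t")
        case True
        then have "(norm (x - y))\<^sup>2 \<le> t\<^sup>2"
          by (intro power_mono) (auto simp: dist_norm)
        moreover have "(2 * t)\<^sup>2 = 4 * t\<^sup>2"
          by (simp add: power_mult_distrib)
        ultimately have "(norm (x - y))\<^sup>2 + t\<^sup>2 \<le> (2 * t)\<^sup>2"
          using zero_le_power2[of t] by linarith
        then have "sqrt ((norm (x - y))\<^sup>2 + t\<^sup>2) \<le> 2 * t"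
          using t by (intro real_le_lsqrt) auto
        from radial_kernel_ge[OF \<open>0 \<le> \<sigma>\<close> r this t(3)]
        have "exp (- 2 * \<sigma>) / (8 * t ^ 3) \<le> g y"
          by (simp add: g_def)
        then have "A \<le> F y * g y"
          unfolding A_def using ball[OF \<open>y \<in> ball x d\<close>] c(1) t by (intro mult_mono) auto
        moreover have "0 \<le> M / d ^ 3" using M d by simp
        ultimately show ?thesis using True by (simp add: mult.commute)
      next
        case False
        moreover have "0 \<le> M / d ^ 3" using M d by simp
        moreover have "0 \<le> g y * F y"
          using g0 ball[OF \<open>y \<in> ball x d\<close>] c(1) by simp
        ultimately show ?thesis by simp
      qed
    next
      case False
      then have far: "d \<le> norm (x - y)" "y \<notin> ball x t"
        using t by (auto simp: dist_norm)
      have "norm (x - y) \<le> sqrt ((norm (x - y))\<^sup>2 + t\<^sup>2)"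
        by (intro real_le_rsqrt) simp
      then have r: "d \<le> sqrt ((norm (x - y))\<^sup>2 + t\<^sup>2)" using far by linarith
      have g: "0 \<le> g y" "g y \<le> 1 / d ^ 3"
        unfolding g_def using radial_kernel_le[OF \<open>0 \<le> \<sigma>\<close> d r] r d \<open>0 \<le> \<sigma>\<close>
        by (auto simp: radial_kernel_def)
      have "\<bar>g y * F y\<bar> \<le> 1 / d ^ 3 * M"
        unfolding abs_mult using g M(2)[OF y] d by (intro mult_mono) auto
      then show ?thesis using far(2) by (simp add: abs_le_iff)
    qed
    from has_integral_le[OF int int_0 this] have "A * measure lborel (ball x t) \<le> M / d ^ 3 * V"
      by simp
    moreover have "measure lborel (ball x t) = unit_ball_vol 2 * t\<^sup>2"
      using t content_ball[of t x] by simp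
    moreover have "A * (unit_ball_vol 2 * t\<^sup>2) = C / t"
      using t by (simp add: A_def C_def power2_eq_square power3_eq_cube)
    ultimately have "C / t \<le> M / d ^ 3 * V"
      by simp
    then show ?thesis
      using t(1) by (simp only: pos_divide_le_eq mult.commute)
  qed
  define L where "L = M / d ^ 3 * V"
  have L: "0 \<le> L" using M d by (simp add: L_def V_def)
  \<comment> \<open>The last entry gives \<open>t * L \<le> C * L / (2 * (L + 1)) < C\<close>; the
    \<open>+ 1\<close> keeps the denominator positive when \<open>L = 0\<close>.\<close>
  define t where "t = min (min (d / 2) 1) (C / (2 * (L + 1)))"
  have "0 < t" "t < d" "t \<le> 1" and t: "t \<le> C / (2 * (L + 1))"
    using d C L by (auto simp: t_def)
  from bound[OF this(1-3)] have "C \<le> t * L"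
    by (simp add: L_def)
  also have "\<dots> \<le> C / (2 * (L + 1)) * L"
    using t L by (rule mult_right_mono)
  also have "\<dots> < C"
    using C L by (simp add: divide_simps)
  finally show False by simp
qed

end

section \<open>Uniqueness from the data on \<open>U\<close>\<close>

lemma C0_infinity_imp_continuous: "f \<in> C0_infinity D \<Longrightarrow> continuous_on UNIV f"
  by (auto simp: C0_infinity_def smooth_def dest!: spec[of _ 0])

lemma eq_0_outside_supp: "y \<notin> supp f \<Longrightarrow> f y = 0"
  using closure_subset[of "{x. f x \<noteq> 0}"] by (auto simp: supp_def)

theorem theorem4p4:
  fixes \<sigma> r\<^sub>0 :: real
    and D U :: "(real^2) set"
    and \<mu>\<^sub>1 \<mu>\<^sub>2 :: "real^2 \<Rightarrow> real"
  assumes "\<sigma> \<ge> 0"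
    and "is_domain D" and "bounded D"
    and "is_domain U" and "bounded U"
    and "setdist U D = r\<^sub>0" and "r\<^sub>0 > 0"
    and "\<mu>\<^sub>1 \<in> C0_infinity D" and "\<And>y. \<mu>\<^sub>1 y \<ge> 0"
    and "\<mu>\<^sub>2 \<in> C0_infinity D" and "\<And>y. \<mu>\<^sub>2 y \<ge> 0"
    and "\<And>x. x \<in> U \<Longrightarrow> T_data \<sigma> \<mu>\<^sub>1 x = T_data \<sigma> \<mu>\<^sub>2 x"
  shows "\<mu>\<^sub>1 = \<mu>\<^sub>2"
proof -
  \<comment> \<open>One set for both densities, so that they and their difference share the same
    box.\<close>
  define S where "S = supp \<mu>\<^sub>1 \<union> supp \<mu>\<^sub>2"
  have S: "compact S" "S \<subseteq> D"
    using assms(8,10) by (auto simp: S_def C0_infinity_def)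
  obtain a where a: "S \<subseteq> cbox (- a) a"
    using S(1) bounded_subset_cbox_symmetric compact_imp_bounded by blast
  let ?\<mu> = "\<lambda>y. \<mu>\<^sub>1 y - \<mu>\<^sub>2 y"
  interpret \<mu>\<^sub>1: compact_density \<mu>\<^sub>1 S "- a" a
    by unfold_locales (use a S assms(8) in \<open>auto simp: C0_infinity_imp_continuous compact_imp_closed
      S_def intro: eq_0_outside_supp\<close>)
  interpret \<mu>\<^sub>2: compact_density \<mu>\<^sub>2 S "- a" a
    by unfold_locales (use a S assms(10) in \<open>auto simp: C0_infinity_imp_continuous compact_imp_closed
      S_def intro: eq_0_outside_supp\<close>)
  interpret compact_density ?\<mu> S "- a" a
    by unfold_locales (use \<mu>\<^sub>1.closed \<mu>\<^sub>1.zero_outside \<mu>\<^sub>2.zero_outside a in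
      \<open>auto intro!: continuous_intros \<mu>\<^sub>1.continuous \<mu>\<^sub>2.continuous\<close>)
  have U: "open U" "U \<noteq> {}"
    using assms(4) by (auto simp: is_domain_def)
  have far: "r\<^sub>0 \<le> norm (x - y)" if "x \<in> U" "y \<in> S" for x y
    using setdist_le_dist[of x U y D] that S(2) assms(6) by (auto simp: dist_norm)
  have base: "pairing (\<lambda>y. yukawa_deriv \<sigma> 0 (of_real ((norm (x - y))\<^sup>2))) = 0" if "x \<in> U" for x
  proof -
    define g where "g y = exp (- \<sigma> * norm (x - y)) / norm (x - y)" for y
    have Q: "open (- {x})" "S \<subseteq> - {x}"
      using far[OF that, of x] assms(7) by auto
    have g: "continuous_on (- {x}) g"
      unfolding g_def by (intro continuous_intros) auto
    have g': "continuous_on (- {x}) (\<lambda>y. complex_of_real (g y))"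
      by (intro continuous_intros g)
    \<comment> \<open>The constant factor cancels. Both integrals become pairings before they are
      subtracted, so linearity is applied on the box, where integrability is known.\<close>
    have "(LINT y|lborel. g y * \<mu>\<^sub>1 y) = (LINT y|lborel. g y * \<mu>\<^sub>2 y)"
      using assms(12)[OF that] by (simp add: T_data_def g_def)
    then have eq: "\<mu>\<^sub>1.pairing (\<lambda>y. of_real (g y)) = \<mu>\<^sub>2.pairing (\<lambda>y. of_real (g y))"
      by (simp only: \<mu>\<^sub>1.pairing_eq_LINT[OF Q g] \<mu>\<^sub>2.pairing_eq_LINT[OF Q g])
    have "pairing (\<lambda>y. yukawa_deriv \<sigma> 0 (of_real ((norm (x - y))\<^sup>2))) = pairing (\<lambda>y. of_real (g y))"
      by (simp add: yukawa_def g_def csqrt_of_real exp_of_real[symmetric] del: of_real_power)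
    also have "\<dots> = \<mu>\<^sub>1.pairing (\<lambda>y. of_real (g y)) - \<mu>\<^sub>2.pairing (\<lambda>y. of_real (g y))"
      unfolding pairing_def \<mu>\<^sub>1.pairing_def \<mu>\<^sub>2.pairing_def
        integral_diff[OF \<mu>\<^sub>1.integrable_mult_density[OF Q g'] \<mu>\<^sub>2.integrable_mult_density[OF Q g'], symmetric]
      by (simp add: right_diff_distrib)
    also have "\<dots> = 0"
      using eq by simp
    finally show ?thesis .
  qed
  have all: "pairing (\<lambda>y. yukawa_deriv \<sigma> n (of_real ((norm (x - y))\<^sup>2))) = 0" if "x \<in> U" for n x
    using that
  proof (induction n arbitrary: x)
    case 0
    then show ?case by (rule base)
  next
    case (Suc n)
    show ?case
      by (rule pairing_yukawa_deriv_Suc[OF U(1) assms(7) far Suc.IH Suc.prems])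
  qed
  obtain x\<^sub>0 where "x\<^sub>0 \<in> U"
    using U(2) by blast
  \<comment> \<open>Order 1 is the concentrating kernel. The zeros of all orders at height 0 above
    \<open>U\<close> give zeros at positive height above \<open>U\<close>, and continuation moves
    these to an arbitrary \<open>x\<close>.\<close>
  have "pairing (\<lambda>y. yukawa_deriv \<sigma> 1 (of_real ((norm (x - y))\<^sup>2 + w))) = 0" if "0 < w" for x w
    by (rule pairing_yukawa_deriv_everywhere[OF U(1) \<open>x\<^sub>0 \<in> U\<close> that])
       (rule pairing_yukawa_deriv_translate[OF assms(7) far all that])
  then have "?\<mu> x = 0" for x
    by (rule density_eq_0[OF assms(1)])
  then show ?thesis
    by (simp add: fun_eq_iff)
qed

end
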